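(* Let $F:\mathbb{R}^d\to\mathbb{R}$ be a differentiable convex function satisfying $\|\nabla F(0)\|\le L$. Let $\lambda,\Delta,r\in\mathbb{R}_{>0}$ with $\Delta\le\frac{\lambda r^2}{100}$. Then the procedure BinarySearch$(\lambda,r,\Delta,L,\mathcal{O}_1,\mathcal{O}_2)$ written out in the context, run with an $(r,2\lambda)$-phase-one oracle $\mathcal{O}_1$ for $F$ and a $\left(\frac{\Delta}{2},r,\max(\alpha_{3r},2\lambda)\right)$-phase-two oracle $\mathcal{O}_2$ for $F$, computes $x\in\mathbb{B}(r)$ satisfying $$F(x)+\lambda\|x\|^2\le\min_{\|y\|\le r}\left\{F(y)+\lambda\|y\|^2\right\}+\Delta.$$ BinarySearch makes at most $O\left(\log\frac{L}{\lambda r}\right)$ calls to $\mathcal{O}_1$, and $O\left(\log\frac{Lr+\lambda r^2}{\Delta}\right)$ calls to $\mathcal{O}_2$.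
   Context: $\|\cdot\|$ is the Euclidean norm and $\mathbb{B}(r)=\{x\in\mathbb{R}^d:\|x\|\le r\}$. For $\alpha>0$, $x^\star_\alpha:=\operatorname{argmin}_{x\in\mathbb{R}^d}F(x)+\frac{\alpha}{2}\|x\|^2$. For $t\in[0,\|x^\star_{2\lambda}\|]$, $\alpha_t$ denotes the unique $\alpha\in[2\lambda,\infty)$ with $\|x^\star_\alpha\|=t$ (with $x^\star_\infty=0$); if $\|x^\star_{2\lambda}\|<3r$, then $\max(\alpha_{3r},2\lambda)$ is read as $2\lambda$. An $(r,\beta)$-phase-one oracle for $F$ is a procedure that on input $\alpha\ge\beta$ returns $x$ satisfying $\|x-x^\star_\alpha\|\le\frac{r+\|x^\star_\alpha\|}{100}$. A $(\Delta,r,\beta)$-phase-two oracle for $F$ is a procedure that on input $\alpha\ge\beta$ returns $x$ satisfying $F(x)+\frac{\alpha}{2}\|x\|^2\le F(x^\star_\alpha)+\frac{\alpha}{2}\|x^\star_\alpha\|^2+\Delta$. If an oracle is called more than once with the same $\alpha$, it is taken to give the same result each time (e.g., the result of the first call). Procedure BinarySearch$(\lambda,r,\Delta,L,\mathcal{O}_1,\mathcal{O}_2)$: Phase one. (1) Set $u\leftarrow2\lambda$. While $\|\mathcal{O}_1(u)\|>2.5r$, set $u\leftarrow2u$. (2) If $u=2\lambda$, set $\alpha'\leftarrow2\lambda$. Otherwise set $\ell\leftarrow\frac{u}{2}$ and repeat the following until a break: set $m\leftarrow\sqrt{u\ell}$; if $\|\mathcal{O}_1(m)\|\in[2.1r,2.9r]$,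 set $\alpha'\leftarrow m$ and break; else if $\|\mathcal{O}_1(m)\|>2.9r$, set $\ell\leftarrow m$; else set $u\leftarrow m$. Phase two. (3) Set $\ell\leftarrow\alpha'$ and $u\leftarrow\frac{4L}{r}+2\lambda$. (4) While $\frac{u}{\ell}>1+\frac{\Delta}{10(Lr+\lambda r^2)}$: set $m\leftarrow\sqrt{u\ell}$; if $\|\mathcal{O}_2(m)\|>r$, set $\ell\leftarrow m$; else set $u\leftarrow m$. (5) Set $x_1\leftarrow\mathcal{O}_2(\ell)$ and $x_2\leftarrow\mathcal{O}_2(u)$. (6) If $\ell=2\lambda$, return $x_2$. Otherwise return $x_{\mathrm{out}}\leftarrow(1-t)x_1+tx_2$, where $t\in[0,1]$ is chosen so that $\|x_{\mathrm{out}}\|=r$. *)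

theory Defs
  imports "HOL-Analysis.Analysis"
begin

section \<open>Euclidean spaces of all finite dimensions inside one type\<close>

text \<open>
  The constants hidden in the bounds on the number of oracle calls must not depend on the dimension,
  so the dimension has to be quantified inside their scope, which is impossible when it is encoded
  in a type such as \<open>real ^ 'n\<close>. Hence all \<open>\<real>\<^sup>d\<close> are realised as subspaces
  \<open>eucl d\<close> of the inner product space of finitely supported real sequences. (The library's finitely
  supported functions do not serve here, as they already carry the \<open>\<ell>\<^sub>1\<close> metric.)
\<close>

typedef fvec = "{f :: nat \<Rightarrow> real. finite {i. f i \<noteq> 0}}"
  morphisms coord Abs_fvec
  by (rule exI[of _ "\<lambda>_. 0"]) simp

setup_lifting type_definition_fvec

lemma finite_coord [simp]: "finite {i. coord x i \<noteq> 0}"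
  using coord[of x] by simp

lemma fvec_eq_iff: "x = y \<longleftrightarrow> (\<forall>i. coord x i = coord y i)"
  by (simp add: coord_inject[symmetric] fun_eq_iff)

instantiation fvec :: real_vector
begin

lift_definition zero_fvec :: fvec is "\<lambda>_. 0"
  by simp

lift_definition plus_fvec :: "fvec \<Rightarrow> fvec \<Rightarrow> fvec" is "\<lambda>f g i. f i + g i"
proof -
  fix f g :: "nat \<Rightarrow> real"
  assume "finite {i. f i \<noteq> 0}" "finite {i. g i \<noteq> 0}"
  then show "finite {i. f i + g i \<noteq> 0}"
    by (rule rev_finite_subset[OF finite_UnI]) auto
qed

lift_definition uminus_fvec :: "fvec \<Rightarrow> fvec" is "\<lambda>f i. - f i"
  by simp

definition minus_fvec :: "fvec \<Rightarrow> fvec \<Rightarrow> fvec" where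
  "x - y = x + - y" for x y :: fvec

lift_definition scaleR_fvec :: "real \<Rightarrow> fvec \<Rightarrow> fvec" is "\<lambda>c f i. c * f i"
  by simp

instance
proof
  fix x y z :: fvec and a b :: real
  note coord_simps = zero_fvec.rep_eq plus_fvec.rep_eq uminus_fvec.rep_eq scaleR_fvec.rep_eq
  show "x + y + z = x + (y + z)" "x + y = y + x" "0 + x = x" "- x + x = 0"
    "a *\<^sub>R (x + y) = a *\<^sub>R x + a *\<^sub>R y" "(a + b) *\<^sub>R x = a *\<^sub>R x + b *\<^sub>R x"
    "a *\<^sub>R b *\<^sub>R x = (a * b) *\<^sub>R x" "1 *\<^sub>R x = x"
    by (simp_all add: fvec_eq_iff coord_simps algebra_simps)
  show "x - y = x + - y" by (rule minus_fvec_def)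
qed

end

instantiation fvec :: real_inner
begin

definition inner_fvec :: "fvec \<Rightarrow> fvec \<Rightarrow> real" where
  "inner x y = (\<Sum>i | coord x i \<noteq> 0. coord x i * coord y i)"

definition norm_fvec :: "fvec \<Rightarrow> real" where
  "norm x = sqrt (inner x x)" for x :: fvec

definition sgn_fvec :: "fvec \<Rightarrow> fvec" where
  "sgn x = x /\<^sub>R norm x" for x :: fvec

definition dist_fvec :: "fvec \<Rightarrow> fvec \<Rightarrow> real" where
  "dist x y = norm (x - y)" for x y :: fvec

definition uniformity_fvec :: "(fvec \<times> fvec) filter" where
  "uniformity_fvec = (INF e\<in>{0 <..}. principal {(x, y). dist x y < e})"

definition open_fvec :: "fvec set \<Rightarrow> bool" where
  "open U \<longleftrightarrow> (\<forall>x\<in>U. eventually (\<lambda>(x', y). x' = x \<longrightarrow> y \<in> U) uniformity)" for U :: "fvec set"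

instance
proof
  fix x y z :: fvec and a :: real
  note coord_simps = zero_fvec.rep_eq plus_fvec.rep_eq uminus_fvec.rep_eq scaleR_fvec.rep_eq
  have inner_sum: "inner v w = (\<Sum>i\<in>A. coord v i * coord w i)"
    if "finite A" "{i. coord v i \<noteq> 0} \<subseteq> A" for A v w
    unfolding inner_fvec_def using that by (intro sum.mono_neutral_left) auto
  show "sgn x = x /\<^sub>R norm x" by (rule sgn_fvec_def)
  show "dist x y = norm (x - y)" by (rule dist_fvec_def)
  show "uniformity = (INF e\<in>{0 <..}. principal {(x, y :: fvec). dist x y < e})"
    by (rule uniformity_fvec_def)
  show "open U \<longleftrightarrow> (\<forall>x\<in>U. eventually (\<lambda>(x', y). x' = x \<longrightarrow> y \<in> U) uniformity)" for U :: "fvec set"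
    by (rule open_fvec_def)
  show "norm x = sqrt (inner x x)" by (rule norm_fvec_def)
  let ?A = "{i. coord x i \<noteq> 0} \<union> {i. coord y i \<noteq> 0}"
  have "inner x y = (\<Sum>i\<in>?A. coord x i * coord y i)" by (rule inner_sum) auto
  moreover have "inner y x = (\<Sum>i\<in>?A. coord y i * coord x i)" by (rule inner_sum) auto
  ultimately show "inner x y = inner y x" by (simp add: mult.commute)
  have "inner (x + y) z = (\<Sum>i\<in>?A. coord (x + y) i * coord z i)"
    by (rule inner_sum) (auto simp: coord_simps)
  moreover have "inner x z = (\<Sum>i\<in>?A. coord x i * coord z i)" by (rule inner_sum) auto
  moreover have "inner y z = (\<Sum>i\<in>?A. coord y i * coord z i)" by (rule inner_sum) auto
  ultimately show "inner (x + y) z = inner x z + inner y z"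
    by (simp add: coord_simps algebra_simps sum.distrib)
  have "inner (a *\<^sub>R x) y = (\<Sum>i\<in>{i. coord x i \<noteq> 0}. coord (a *\<^sub>R x) i * coord y i)"
    by (rule inner_sum) (auto simp: coord_simps)
  then show "inner (a *\<^sub>R x) y = a * inner x y"
    by (simp add: inner_fvec_def coord_simps sum_distrib_left mult.assoc)
  show "0 \<le> inner x x"
    unfolding inner_fvec_def by (intro sum_nonneg) auto
  show "inner x x = 0 \<longleftrightarrow> x = 0"
    unfolding inner_fvec_def
    by (subst sum_nonneg_eq_0_iff) (auto simp: fvec_eq_iff coord_simps)
qed

end

definition eucl :: "nat \<Rightarrow> fvec set" where
  "eucl d = {x. \<forall>i\<ge>d. coord x i = 0}"

lemma subspace_eucl: "subspace (eucl d)"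
  by (simp add: subspace_def eucl_def zero_fvec.rep_eq plus_fvec.rep_eq scaleR_fvec.rep_eq)

lemma inner_eucl: "x \<in> eucl d \<Longrightarrow> inner x y = (\<Sum>i<d. coord x i * coord y i)"
  unfolding inner_fvec_def eucl_def
  by (intro sum.mono_neutral_left) (auto simp: not_le[symmetric])


section \<open>Regularised minimisers and the oracles\<close>

text \<open>
  Only the values of \<open>F\<close> on \<open>eucl d\<close> matter in what follows. On that subspace the gradient is
  unique if it exists.
\<close>

definition grad :: "nat \<Rightarrow> (fvec \<Rightarrow> real) \<Rightarrow> fvec \<Rightarrow> fvec" where
  "grad d F x = (THE g. g \<in> eucl d \<and> (F has_derivative (\<lambda>h. inner g h)) (at x within eucl d))"

definition xstar :: "nat \<Rightarrow> (fvec \<Rightarrow> real) \<Rightarrow> real \<Rightarrow> fvec" where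
  "xstar d F \<alpha> = arg_min_on (\<lambda>x. F x + \<alpha> / 2 * (norm x)\<^sup>2) (eucl d)"

text \<open>
  The number \<open>\<alpha>\<^sub>t\<close>, for \<open>0 < t \<le> norm (xstar d F (2 * lam))\<close>.
\<close>

definition alpha_at :: "nat \<Rightarrow> (fvec \<Rightarrow> real) \<Rightarrow> real \<Rightarrow> real \<Rightarrow> real" where
  "alpha_at d F lam t = (THE \<alpha>. 2 * lam \<le> \<alpha> \<and> norm (xstar d F \<alpha>) = t)"

text \<open>
  The value of \<open>max(\<alpha>\<^sub>3\<^sub>r, 2\<lambda>)\<close>, with the convention that it is \<open>2\<lambda>\<close> when
  \<open>\<alpha>\<^sub>3\<^sub>r\<close> does not exist.
\<close>

definition phase_two_threshold :: "nat \<Rightarrow> (fvec \<Rightarrow> real) \<Rightarrow> real \<Rightarrow> real \<Rightarrow> real" where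
  "phase_two_threshold d F lam r =
     (if norm (xstar d F (2 * lam)) < 3 * r then 2 * lam
      else max (alpha_at d F lam (3 * r)) (2 * lam))"

text \<open>
  Oracles are functions, as repeated calls with the same argument give the same result; nothing is
  known about their values at arguments below \<open>\<beta>\<close>. The parameter \<open>r\<close> of a phase-two oracle plays no
  role in its guarantee and is kept only so that the parameters are those of a
  \<open>(\<Delta>, r, \<beta>)\<close>-phase-two oracle.
\<close>

definition phase_one_oracle ::
    "nat \<Rightarrow> (fvec \<Rightarrow> real) \<Rightarrow> real \<Rightarrow> real \<Rightarrow> (real \<Rightarrow> fvec) \<Rightarrow> bool" where
  "phase_one_oracle d F r \<beta> O1 \<longleftrightarrow>
     (\<forall>\<alpha>\<ge>\<beta>. O1 \<alpha> \<in> eucl d \<and>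
        norm (O1 \<alpha> - xstar d F \<alpha>) \<le> (r + norm (xstar d F \<alpha>)) / 100)"

definition phase_two_oracle ::
    "nat \<Rightarrow> (fvec \<Rightarrow> real) \<Rightarrow> real \<Rightarrow> real \<Rightarrow> real \<Rightarrow> (real \<Rightarrow> fvec) \<Rightarrow> bool" where
  "phase_two_oracle d F \<Delta> r \<beta> O2 \<longleftrightarrow>
     (\<forall>\<alpha>\<ge>\<beta>. O2 \<alpha> \<in> eucl d \<and>
        F (O2 \<alpha>) + \<alpha> / 2 * (norm (O2 \<alpha>))\<^sup>2
          \<le> F (xstar d F \<alpha>) + \<alpha> / 2 * (norm (xstar d F \<alpha>))\<^sup>2 + \<Delta>)"


section \<open>The procedure\<close>

text \<open>
  Each loop is a partial function whose value is \<open>None\<close> iff the loop does not terminate. The last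
  argument \<open>n\<close> counts oracle calls: every evaluation of an oracle in the pseudocode is counted, even
  when it repeats an earlier one.
\<close>

partial_function (option) doubling ::
    "(real \<Rightarrow> fvec) \<Rightarrow> real \<Rightarrow> real \<Rightarrow> nat \<Rightarrow> (real \<times> nat) option" where
  "doubling O1 r u n =
     (if norm (O1 u) > 5/2 * r then doubling O1 r (2 * u) (n + 1)
      else Some (u, n + 1))"

partial_function (option) bisection_one ::
    "(real \<Rightarrow> fvec) \<Rightarrow> real \<Rightarrow> real \<Rightarrow> real \<Rightarrow> nat \<Rightarrow> (real \<times> nat) option" where
  "bisection_one O1 r l u n =
     (let m = sqrt (u * l) in
      if norm (O1 m) \<in> {21/10 * r .. 29/10 * r} then Some (m, n + 1)
      else if norm (O1 m) > 29/10 * r then bisection_one O1 r m u (n + 2)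
      else bisection_one O1 r l m (n + 2))"

definition phase_one :: "real \<Rightarrow> real \<Rightarrow> (real \<Rightarrow> fvec) \<Rightarrow> (real \<times> nat) option" where
  "phase_one lam r O1 =
     Option.bind (doubling O1 r (2 * lam) 0)
       (\<lambda>(u, n). if u = 2 * lam then Some (2 * lam, n) else bisection_one O1 r (u / 2) u n)"

partial_function (option) bisection_two ::
    "(real \<Rightarrow> fvec) \<Rightarrow> real \<Rightarrow> real \<Rightarrow> real \<Rightarrow> real \<Rightarrow> nat \<Rightarrow> (real \<times> real \<times> nat) option" where
  "bisection_two O2 r tol l u n =
     (if u / l > 1 + tol then
        let m = sqrt (u * l) in
        if norm (O2 m) > r then bisection_two O2 r tol m u (n + 1)
        else bisection_two O2 r tol l m (n + 1)
      else Some (l, u, n))"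

text \<open>
  \<open>binary_search lam r \<Delta> L O1 O2 x n1 n2\<close>: some run of the procedure terminates and returns \<open>x\<close> after
  \<open>n1\<close> calls to \<open>O1\<close> and \<open>n2\<close> calls to \<open>O2\<close>. It is a relation because of the choice of \<open>t\<close> in the
  last step, which is the only nondeterministic one.
\<close>

definition binary_search ::
    "real \<Rightarrow> real \<Rightarrow> real \<Rightarrow> real \<Rightarrow> (real \<Rightarrow> fvec) \<Rightarrow> (real \<Rightarrow> fvec) \<Rightarrow> fvec \<Rightarrow> nat \<Rightarrow> nat \<Rightarrow> bool" where
  "binary_search lam r \<Delta> L O1 O2 x n1 n2 \<longleftrightarrow>
     (\<exists>\<alpha>' l u n x1 x2.
        phase_one lam r O1 = Some (\<alpha>', n1) \<and>
        bisection_two O2 r (\<Delta> / (10 * (L * r + lam * r\<^sup>2))) \<alpha>' (4 * L / r + 2 * lam) 0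
          = Some (l, u, n) \<and>
        x1 = O2 l \<and> x2 = O2 u \<and> n2 = n + 2 \<and>
        (if l = 2 * lam then x = x2
         else \<exists>t\<in>{0..1}. x = (1 - t) *\<^sub>R x1 + t *\<^sub>R x2 \<and> norm x = r))"

end

theory Submission
  imports Defs
begin

text \<open>
  Write \<open>x\<^sub>\<alpha>\<close> for the minimiser of \<open>F x + \<alpha> / 2 * (norm x)\<^sup>2\<close>. Everything rests on how \<open>norm x\<^sub>\<alpha>\<close>
  varies with \<open>\<alpha>\<close>. The subgradient inequalities at two parameters \<open>\<beta> \<le> \<alpha>\<close> add up to
  \<open>(\<alpha> * norm x\<^sub>\<alpha> - \<beta> * norm x\<^sub>\<beta>) * (norm x\<^sub>\<alpha> - norm x\<^sub>\<beta>) \<le> 0\<close>. Hence \<open>norm x\<^sub>\<alpha>\<close> decreases while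
  \<open>\<alpha> * norm x\<^sub>\<alpha>\<close> increases (\<open>norm_xmin_antimono\<close>, \<open>scaled_norm_xmin_mono\<close>): the logarithm of
  the norm is a nonincreasing 1-Lipschitz function of the logarithm of the parameter. Moreover
  \<open>\<alpha> * norm x\<^sub>\<alpha> \<le> L\<close> (\<open>norm_xmin_le\<close>), since convexity bounds \<open>F\<close> below by its tangent at the
  origin.

  Phase one. Doubling stops once \<open>u \<ge> L / r\<close>, which is the only source of the logarithm in the
  number of calls to \<open>O1\<close>. The bisection that follows takes boundedly many steps: after each failed
  step the norms of the minimisers at the two ends differ by a factor above \<open>28/25\<close>, so by the
  Lipschitz property the parameters do so too, but their ratio, initially 2, is replaced by its
  square root in each step (\<open>bisection_one_step\<close>). The parameter \<open>\<alpha>'\<close> found satisfies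
  \<open>norm x\<^sub>\<alpha>' < 3 * r\<close>; as the norm is monotone, \<open>\<alpha>'\<close> is above the threshold from which on \<open>O2\<close> is
  reliable. This needs \<open>\<alpha>\<^sub>3\<^sub>r\<close> to exist, by the intermediate value theorem, and to be unique: two
  parameters with minimisers of equal nonzero norm would have the same minimiser \<open>x\<close>, and then the
  gradient at \<open>x\<close> determines the parameter (\<open>norm_xmin_inj\<close>).

  Phase two. The bisection again takes square roots of the ratio \<open>u / l\<close>, and by Bernoulli's
  inequality the number of steps is logarithmic in the initial ratio divided by the tolerance. At
  the end \<open>l\<close> and \<open>u\<close> are so close that \<open>O2 l\<close> and \<open>O2 u\<close> are both \<open>\<Delta>\<close>-minimisers of the
  objective regularised with \<open>l\<close> (\<open>interpolation_nearly_optimal\<close>); by convexity so is any point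
  between them. If such a point \<open>x\<close> has norm exactly \<open>r\<close>, the surplus term
  \<open>(l / 2 - lam) * (norm y)\<^sup>2\<close> is largest over the ball at \<open>y = x\<close>, so \<open>x\<close> also is
  \<open>\<Delta>\<close>-optimal for the constrained problem. If instead \<open>l\<close> still equals \<open>2 * lam\<close>, the
  regularisation with \<open>u\<close> is almost the original one (\<open>boundary_nearly_optimal\<close>).
\<close>


section \<open>Linear functionals and compact boxes\<close>

lift_definition unit_vec :: "nat \<Rightarrow> fvec" is "\<lambda>k i. if i = k then 1 else 0"
  by simp

lemmas coord_simps = zero_fvec.rep_eq plus_fvec.rep_eq uminus_fvec.rep_eq scaleR_fvec.rep_eq
  unit_vec.rep_eq

lemma coord_diff: "coord (x - y) i = coord x i - coord y i"
  unfolding minus_fvec_def coord_simps by simp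

lemma coord_sum: "coord (sum f A) i = (\<Sum>k\<in>A. coord (f k) i)"
  by (induction A rule: infinite_finite_induct) (simp_all add: coord_simps)

lemma inner_unit_vec: "inner (unit_vec k) x = coord x k"
proof -
  have "{i. coord (unit_vec k) i \<noteq> 0} = {k}" by (auto simp: coord_simps)
  then show ?thesis by (simp add: inner_fvec_def coord_simps)
qed

lemma norm_unit_vec: "norm (unit_vec k) = 1"
  by (simp add: norm_eq_sqrt_inner inner_unit_vec coord_simps)

lemma abs_coord_le_norm: "\<bar>coord x i\<bar> \<le> norm x"
  using Cauchy_Schwarz_ineq2[of "unit_vec i" x] by (simp add: inner_unit_vec norm_unit_vec)

lemma unit_vec_in_eucl: "k < d \<Longrightarrow> unit_vec k \<in> eucl d"
  by (auto simp: eucl_def coord_simps)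

lemma eucl_expansion:
  assumes "x \<in> eucl d"
  shows "x = (\<Sum>i<d. coord x i *\<^sub>R unit_vec i)"
  using assms by (auto simp: fvec_eq_iff coord_sum coord_simps eucl_def if_distrib cong: if_cong)

text \<open>
  The Riesz representation in finite dimension, by expansion in coordinates; it turns a derivative
  into a gradient.
\<close>

lemma linear_functional_eq_inner:
  fixes D :: "fvec \<Rightarrow> real"
  assumes "linear D"
  obtains g where "g \<in> eucl d" "\<And>h. h \<in> eucl d \<Longrightarrow> D h = inner g h"
proof
  let ?g = "\<Sum>i<d. D (unit_vec i) *\<^sub>R unit_vec i"
  show "?g \<in> eucl d"
    by (intro subspace_sum subspace_scale subspace_eucl unit_vec_in_eucl) auto
  fix h assume h: "h \<in> eucl d"
  have "D h = D (\<Sum>i<d. coord h i *\<^sub>R unit_vec i)"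
    using eucl_expansion[OF h] by simp
  also have "\<dots> = (\<Sum>i<d. coord h i * D (unit_vec i))"
    using assms by (simp add: linear_sum linear_scale)
  also have "\<dots> = inner ?g h"
    by (simp add: inner_sum_left inner_unit_vec mult.commute)
  finally show "D h = inner ?g h" .
qed

text \<open>
  Boxes replace balls because they are products of intervals, which gives their compactness by
  induction on the dimension; they are still large enough to contain the minimisers sought.
\<close>

definition box_eucl :: "nat \<Rightarrow> real \<Rightarrow> fvec set" where
  "box_eucl d R = {x \<in> eucl d. \<forall>i. \<bar>coord x i\<bar> \<le> R}"

lemma box_eucl_Suc:
  assumes "R \<ge> 0"
  shows "box_eucl (Suc d) R = (\<lambda>(a, x). x + a *\<^sub>R unit_vec d) ` ({-R..R} \<times> box_eucl d R)"
proof (intro equalityI subsetI)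
  fix x assume x: "x \<in> box_eucl (Suc d) R"
  have "coord x d \<in> {-R..R}" using x by (simp add: box_eucl_def abs_le_iff minus_le_iff)
  moreover have "x - coord x d *\<^sub>R unit_vec d \<in> box_eucl d R"
  proof -
    have "coord (x - coord x d *\<^sub>R unit_vec d) i = (if i = d then 0 else coord x i)" for i
      by (simp add: coord_diff coord_simps)
    moreover have "coord x i = 0" if "i \<ge> d" "i \<noteq> d" for i
      using x that by (simp add: box_eucl_def eucl_def)
    ultimately show ?thesis using x assms unfolding box_eucl_def eucl_def by simp
  qed
  ultimately show "x \<in> (\<lambda>(a, x). x + a *\<^sub>R unit_vec d) ` ({-R..R} \<times> box_eucl d R)"
    by (intro image_eqI[of _ _ "(coord x d, x - coord x d *\<^sub>R unit_vec d)"]) auto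
qed (auto simp: box_eucl_def eucl_def coord_simps)

lemma compact_box_eucl:
  assumes "R \<ge> 0"
  shows "compact (box_eucl d R)"
proof (induction d)
  case 0
  have "box_eucl 0 R = {0}" using assms
    by (auto simp: box_eucl_def eucl_def fvec_eq_iff coord_simps)
  then show ?case by simp
next
  case (Suc d)
  have "continuous_on ({-R..R} \<times> box_eucl d R) (\<lambda>(a, x). x + a *\<^sub>R unit_vec d)"
    unfolding case_prod_beta by (intro continuous_intros)
  with Suc show ?case
    unfolding box_eucl_Suc[OF assms] by (intro compact_continuous_image compact_Times) auto
qed


section \<open>The gradient on a subspace\<close>

lemma has_real_derivative_along_line:
  fixes F :: "fvec \<Rightarrow> real"
  assumes F: "(F has_derivative D) (at x within eucl d)" and x: "x \<in> eucl d" and h: "h \<in> eucl d"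
  shows "((\<lambda>t. F (x + t *\<^sub>R h)) has_real_derivative D h) (at 0)"
proof -
  have line: "((\<lambda>t. x + t *\<^sub>R h) has_derivative (\<lambda>t. t *\<^sub>R h)) (at 0)"
    by (auto intro!: derivative_eq_intros)
  have "range (\<lambda>t. x + t *\<^sub>R h) \<subseteq> eucl d"
    using x h subspace_eucl by (auto intro!: subspace_add subspace_scale)
  then have "(F has_derivative D) (at (x + 0 *\<^sub>R h) within range (\<lambda>t. x + t *\<^sub>R h))"
    using F by (auto intro: has_derivative_subset)
  from has_derivative_in_compose[OF line this]
  have "((\<lambda>t. F (x + t *\<^sub>R h)) has_derivative (\<lambda>t. D (t *\<^sub>R h))) (at 0)" by simp
  moreover have "D (t *\<^sub>R h) = D h * t" for t
    using has_derivative_linear[OF F] by (simp add: linear_scale)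
  ultimately show ?thesis by (simp add: has_field_derivative_def)
qed

text \<open>
  Restricting a derivative to the subspace and representing it by a vector of the subspace gives
  existence; for uniqueness, two candidate gradients have equal inner products with their difference.
\<close>

lemma grad_has_derivative:
  fixes F :: "fvec \<Rightarrow> real"
  assumes "F differentiable_on eucl d" and x: "x \<in> eucl d"
  shows "grad d F x \<in> eucl d" "(F has_derivative (\<lambda>h. inner (grad d F x) h)) (at x within eucl d)"
proof -
  let ?P = "\<lambda>g. g \<in> eucl d \<and> (F has_derivative (\<lambda>h. inner g h)) (at x within eucl d)"
  obtain D where D: "(F has_derivative D) (at x within eucl d)"
    using assms by (auto simp: differentiable_on_def differentiable_def)
  obtain g where g: "g \<in> eucl d" "\<And>h. h \<in> eucl d \<Longrightarrow> D h = inner g h"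
    using linear_functional_eq_inner[OF has_derivative_linear[OF D]] by metis
  have "((\<lambda>y. norm (F y - F x - inner g (y - x)) / norm (y - x)) \<longlongrightarrow> 0) (at x within eucl d)
    \<longleftrightarrow> ((\<lambda>y. norm (F y - F x - D (y - x)) / norm (y - x)) \<longlongrightarrow> 0) (at x within eucl d)"
    using g(2) x subspace_eucl
    by (intro filterlim_cong refl) (auto simp: eventually_at_filter subspace_diff)
  then have "?P g"
    using g(1) D by (auto simp: has_derivative_iff_norm bounded_linear_inner_right)
  moreover have "g' = g" if g': "?P g'" for g'
  proof -
    have h: "g' - g \<in> eucl d" using g' g(1) subspace_eucl by (simp add: subspace_diff)
    have "inner g' (g' - g) = inner g (g' - g)"
      using has_real_derivative_along_line[OF conjunct2[OF g'] x h]
        has_real_derivative_along_line[OF conjunct2[OF \<open>?P g\<close>] x h]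
      by (rule DERIV_unique)
    then have "inner (g' - g) (g' - g) = 0" by (simp add: inner_diff_left)
    then show ?thesis by simp
  qed
  ultimately have "\<exists>!g. ?P g" by blast
  from theI'[OF this, folded grad_def]
  show "grad d F x \<in> eucl d" "(F has_derivative (\<lambda>h. inner (grad d F x) h)) (at x within eucl d)"
    by auto
qed

text \<open>
  The difference quotients of a convex function along a segment never exceed the slope of the chord,
  hence neither does their limit.
\<close>

lemma convex_on_ge_tangent:
  fixes F :: "fvec \<Rightarrow> real"
  assumes convex: "convex_on (eucl d) F" and diff: "F differentiable_on eucl d"
    and x: "x \<in> eucl d" and y: "y \<in> eucl d"
  shows "F y \<ge> F x + inner (grad d F x) (y - x)"
proof -
  have h: "y - x \<in> eucl d" using x y subspace_eucl by (simp add: subspace_diff)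
  have "((\<lambda>t. F (x + t *\<^sub>R (y - x))) has_real_derivative inner (grad d F x) (y - x)) (at 0)"
    by (rule has_real_derivative_along_line[OF grad_has_derivative(2)[OF diff x] x h])
  then have "((\<lambda>t. (F (x + t *\<^sub>R (y - x)) - F x) / t) \<longlongrightarrow> inner (grad d F x) (y - x)) (at_right 0)"
    by (auto simp: has_field_derivative_iff intro: filterlim_mono[OF _ order_refl at_le])
  moreover have "\<forall>\<^sub>F t in at_right 0. (F (x + t *\<^sub>R (y - x)) - F x) / t \<le> F y - F x"
    unfolding eventually_at_right_field
  proof (intro exI[of _ 1] conjI allI impI)
    fix t :: real assume t: "0 < t" "t < 1"
    have "F ((1 - t) *\<^sub>R x + t *\<^sub>R y) \<le> (1 - t) * F x + t * F y"
      using convex x y t by (intro convex_onD) auto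
    then show "(F (x + t *\<^sub>R (y - x)) - F x) / t \<le> F y - F x"
      using t by (simp add: field_simps scaleR_diff_right)
  qed simp
  ultimately have "inner (grad d F x) (y - x) \<le> F y - F x"
    by (rule tendsto_upperbound) simp
  then show ?thesis by simp
qed


section \<open>Regularised minimisers\<close>

lemma power2_norm_convex_combination:
  fixes x y :: "'a :: real_inner"
  shows "(norm ((1 - t) *\<^sub>R x + t *\<^sub>R y))\<^sup>2 =
    (1 - t) * (norm x)\<^sup>2 + t * (norm y)\<^sup>2 - t * (1 - t) * (norm (y - x))\<^sup>2"
  unfolding power2_norm_eq_inner
  by (simp add: inner_add_left inner_add_right inner_diff_left inner_diff_right inner_commute
      algebra_simps power2_eq_square)

locale smooth_convex =
  fixes d :: nat and F :: "fvec \<Rightarrow> real" and L :: real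
  assumes convex: "convex_on (eucl d) F"
    and diff: "F differentiable_on eucl d"
    and norm_grad_le: "norm (grad d F 0) \<le> L"
begin

abbreviation xmin :: "real \<Rightarrow> fvec" where "xmin \<equiv> xstar d F"

lemma zero_in_eucl: "0 \<in> eucl d"
  using subspace_eucl by (rule subspace_0)

lemma L_nonneg: "0 \<le> L"
  using norm_grad_le norm_ge_zero order_trans by blast

text \<open>
  This linear lower bound makes every regularised objective coercive.
\<close>

lemma F_lower_bound:
  assumes "x \<in> eucl d"
  shows "F x \<ge> F 0 - L * norm x"
proof -
  have "- inner (grad d F 0) x \<le> norm (grad d F 0) * norm x"
    using Cauchy_Schwarz_ineq2[of "grad d F 0" x] by linarith
  also have "\<dots> \<le> L * norm x" using norm_grad_le by (intro mult_right_mono) auto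
  finally show ?thesis
    using convex_on_ge_tangent[OF convex diff zero_in_eucl assms] by simp
qed

lemma xmin_exists:
  assumes "\<alpha> > 0"
  shows "\<exists>x\<in>eucl d. \<forall>y\<in>eucl d. F x + \<alpha> / 2 * (norm x)\<^sup>2 \<le> F y + \<alpha> / 2 * (norm y)\<^sup>2"
proof -
  let ?f = "\<lambda>x. F x + \<alpha> / 2 * (norm x)\<^sup>2"
  define R where "R = 2 * L / \<alpha>"
  have R: "R \<ge> 0" using L_nonneg assms by (simp add: R_def)
  have sub: "box_eucl d R \<subseteq> eucl d" by (auto simp: box_eucl_def)
  have zero: "0 \<in> box_eucl d R" using R zero_in_eucl by (simp add: box_eucl_def coord_simps)
  have "continuous_on (box_eucl d R) F"
    using differentiable_imp_continuous_on[OF diff] sub continuous_on_subset by blast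
  then have "continuous_on (box_eucl d R) ?f" by (intro continuous_intros)
  then obtain x where x: "x \<in> box_eucl d R" "\<And>y. y \<in> box_eucl d R \<Longrightarrow> ?f x \<le> ?f y"
    using continuous_attains_inf[OF compact_box_eucl[OF R], of d ?f] zero by blast
  have "?f x \<le> ?f y" if y: "y \<in> eucl d" for y
  proof (cases "y \<in> box_eucl d R")
    case False
    then have "norm y > R" using y by (auto simp: box_eucl_def not_le intro: less_le_trans[OF _ abs_coord_le_norm])
    then have "L \<le> \<alpha> / 2 * norm y" using assms by (simp add: R_def field_simps)
    then have "L * norm y \<le> \<alpha> / 2 * norm y * norm y" by (intro mult_right_mono) auto
    then have "?f 0 \<le> ?f y"
      using F_lower_bound[OF y] by (simp add: power2_eq_square mult.assoc)
    with x(2)[OF zero] show ?thesis by linarith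
  qed (use x in auto)
  with x(1) sub show ?thesis by blast
qed

lemma
  assumes "\<alpha> > 0"
  shows xmin_in_eucl: "xmin \<alpha> \<in> eucl d"
    and xmin_le: "y \<in> eucl d \<Longrightarrow>
      F (xmin \<alpha>) + \<alpha> / 2 * (norm (xmin \<alpha>))\<^sup>2 \<le> F y + \<alpha> / 2 * (norm y)\<^sup>2"
proof -
  let ?f = "\<lambda>x. F x + \<alpha> / 2 * (norm x)\<^sup>2"
  have "\<exists>x. is_arg_min ?f (\<lambda>x. x \<in> eucl d) x"
    using xmin_exists[OF assms] by (auto simp: is_arg_min_linorder)
  then have "is_arg_min ?f (\<lambda>x. x \<in> eucl d) (xmin \<alpha>)"
    unfolding xstar_def arg_min_on_def arg_min_def by (rule someI_ex)
  then show "xmin \<alpha> \<in> eucl d" "y \<in> eucl d \<Longrightarrow> ?f (xmin \<alpha>) \<le> ?f y"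
    by (auto simp: is_arg_min_linorder)
qed

text \<open>
  Compare the minimiser \<open>x\<close> with the point at fraction \<open>t\<close> of the way to \<open>y\<close>. The strong convexity
  of the regulariser contributes the term with \<open>t * (1 - t)\<close>; divide by \<open>t\<close> and let \<open>t\<close> tend to 0.
\<close>

lemma xmin_quadratic_growth:
  assumes \<alpha>: "\<alpha> > 0" and y: "y \<in> eucl d"
  shows "F (xmin \<alpha>) + \<alpha> / 2 * (norm (xmin \<alpha>))\<^sup>2 + \<alpha> / 2 * (norm (y - xmin \<alpha>))\<^sup>2
    \<le> F y + \<alpha> / 2 * (norm y)\<^sup>2"
proof -
  define x where "x = xmin \<alpha>"
  let ?f = "\<lambda>x. F x + \<alpha> / 2 * (norm x)\<^sup>2"
  let ?q = "\<alpha> / 2 * (norm (y - x))\<^sup>2"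
  have x: "x \<in> eucl d" using xmin_in_eucl[OF \<alpha>] by (simp add: x_def)
  have step: "?f x + (1 - t) * ?q \<le> ?f y" if t: "0 < t" "t < 1" for t
  proof -
    let ?z = "(1 - t) *\<^sub>R x + t *\<^sub>R y"
    have "?z \<in> eucl d" using x y subspace_eucl by (intro subspace_add subspace_scale)
    then have "?f x \<le> ?f ?z" using xmin_le[OF \<alpha>] by (simp add: x_def)
    moreover have "F ?z \<le> (1 - t) * F x + t * F y"
      using convex x y t by (intro convex_onD) auto
    ultimately have "?f x \<le> (1 - t) * F x + t * F y + \<alpha> / 2 * (norm ?z)\<^sup>2" by linarith
    also have "\<dots> = (1 - t) * ?f x + t * ?f y - t * (1 - t) * ?q"
      unfolding power2_norm_convex_combination by (simp add: field_simps)
    finally have "?f x \<le> (1 - t) * ?f x + t * ?f y - t * (1 - t) * ?q" .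
    moreover have "(1 - t) * ?f x = ?f x - t * ?f x" by (simp only: left_diff_distrib mult_1_left)
    ultimately have "t * (?f x + (1 - t) * ?q) \<le> t * ?f y"
      unfolding distrib_left mult.assoc by linarith
    then show ?thesis using t by (simp only: mult_le_cancel_left_pos)
  qed
  have "((\<lambda>t. ?f x + (1 - t) * ?q) \<longlongrightarrow> ?f x + (1 - 0) * ?q) (at_right 0)"
    by (intro tendsto_intros)
  moreover have "\<forall>\<^sub>F t in at_right 0. ?f x + (1 - t) * ?q \<le> ?f y"
    unfolding eventually_at_right_field using step by (intro exI[of _ 1]) auto
  ultimately have "?f x + (1 - 0) * ?q \<le> ?f y" by (rule tendsto_upperbound) simp
  then show ?thesis by (simp add: x_def)
qed

text \<open>
  Quadratic growth with the squares expanded: \<open>- \<alpha> *\<^sub>R xmin \<alpha>\<close> is a subgradient of \<open>F\<close> at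
  \<open>xmin \<alpha>\<close>. This form makes it possible to compare minimisers for different parameters.
\<close>

lemma xmin_subgradient:
  assumes "\<alpha> > 0" "y \<in> eucl d"
  shows "F y \<ge> F (xmin \<alpha>) - \<alpha> * inner (xmin \<alpha>) (y - xmin \<alpha>)"
  using xmin_quadratic_growth[OF assms] unfolding power2_norm_eq_inner
  by (simp add: inner_diff_left inner_diff_right inner_commute algebra_simps)

text \<open>
  Bound the decrease \<open>F 0 - F x\<close> at the minimiser \<open>x\<close> from below by the subgradient inequality at
  \<open>x\<close>, and from above by the tangent at the origin.
\<close>

lemma norm_xmin_le:
  assumes "\<alpha> > 0"
  shows "\<alpha> * norm (xmin \<alpha>) \<le> L"
proof -
  let ?x = "xmin \<alpha>"
  have "\<alpha> * (norm ?x)\<^sup>2 \<le> F 0 - F ?x"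
    using xmin_subgradient[OF assms zero_in_eucl] by (simp add: power2_norm_eq_inner)
  also have "\<dots> \<le> L * norm ?x" using F_lower_bound[OF xmin_in_eucl[OF assms]] by simp
  finally have "(\<alpha> * norm ?x) * norm ?x \<le> L * norm ?x" by (simp add: power2_eq_square mult.assoc)
  then show ?thesis using L_nonneg by (cases "norm ?x = 0") auto
qed

text \<open>
  The monotonicity of the subdifferential: the subgradient inequalities at the two minimisers are
  added.
\<close>

lemma xmin_monotone:
  assumes "\<beta> > 0" "\<alpha> > 0"
  shows "\<alpha> * (norm (xmin \<alpha>))\<^sup>2 + \<beta> * (norm (xmin \<beta>))\<^sup>2 \<le> (\<alpha> + \<beta>) * inner (xmin \<alpha>) (xmin \<beta>)"
  using xmin_subgradient[OF assms(1) xmin_in_eucl[OF assms(2)]]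
    xmin_subgradient[OF assms(2) xmin_in_eucl[OF assms(1)]]
  unfolding power2_norm_eq_inner
  by (simp add: inner_diff_right inner_commute algebra_simps)

text \<open>
  By the Cauchy-Schwarz inequality monotonicity becomes a statement about the norms alone, which
  factors. The first factor is positive if the second is, and so the two signs are determined.
\<close>

lemma
  assumes "0 < \<beta>" "\<beta> \<le> \<alpha>"
  shows norm_xmin_antimono: "norm (xmin \<alpha>) \<le> norm (xmin \<beta>)"
    and scaled_norm_xmin_mono: "\<beta> * norm (xmin \<beta>) \<le> \<alpha> * norm (xmin \<alpha>)"
proof -
  define a where "a = norm (xmin \<alpha>)"
  define b where "b = norm (xmin \<beta>)"
  have nonneg: "0 \<le> a" "0 \<le> b" by (simp_all add: a_def b_def)
  have "\<alpha> * a\<^sup>2 + \<beta> * b\<^sup>2 \<le> (\<alpha> + \<beta>) * inner (xmin \<alpha>) (xmin \<beta>)"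
    using xmin_monotone[of \<beta> \<alpha>] assms by (simp add: a_def b_def)
  also have "\<dots> \<le> (\<alpha> + \<beta>) * (a * b)"
    using assms norm_cauchy_schwarz[of "xmin \<alpha>" "xmin \<beta>"]
    by (intro mult_left_mono) (auto simp: a_def b_def)
  finally have factored: "(\<alpha> * a - \<beta> * b) * (a - b) \<le> 0"
    by (simp add: algebra_simps power2_eq_square)
  have "a \<le> b"
  proof (rule ccontr)
    assume "\<not> a \<le> b"
    moreover have "\<beta> * b < \<alpha> * a"
      using calculation assms nonneg by (intro mult_le_less_imp_less) auto
    ultimately have "(\<alpha> * a - \<beta> * b) * (a - b) > 0" by simp
    with factored show False by simp
  qed
  moreover have "\<beta> * b \<le> \<alpha> * a"
  proof (cases "a = b")
    case True
    then show ?thesis using assms nonneg by (simp add: mult_right_mono)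
  next
    case False
    with \<open>a \<le> b\<close> factored show ?thesis by (simp add: mult_le_0_iff)
  qed
  ultimately show "norm (xmin \<alpha>) \<le> norm (xmin \<beta>)" "\<beta> * norm (xmin \<beta>) \<le> \<alpha> * norm (xmin \<alpha>)"
    by (simp_all add: a_def b_def)
qed

text \<open>
  Equality of the norms forces equality in the Cauchy-Schwarz inequality, hence a common minimiser
  \<open>x\<close>. Differentiability is essential: at a kink, a whole interval of parameters can share the same
  minimiser. The derivative of \<open>F\<close> in direction \<open>x\<close> is \<open>- \<gamma> * (norm x)\<^sup>2\<close> for each
  parameter \<open>\<gamma>\<close> with minimiser \<open>x\<close>, which determines \<open>\<gamma>\<close>.
\<close>

lemma norm_xmin_inj:
  assumes "0 < \<beta>" "0 < \<alpha>" and eq: "norm (xmin \<alpha>) = norm (xmin \<beta>)" and pos: "norm (xmin \<beta>) > 0"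
  shows "\<alpha> = \<beta>"
proof -
  define x where "x = xmin \<beta>"
  have "(\<alpha> + \<beta>) * (norm x)\<^sup>2 \<le> (\<alpha> + \<beta>) * inner (xmin \<alpha>) x"
    using xmin_monotone[OF assms(1,2)] eq by (simp add: x_def algebra_simps)
  then have "(norm x)\<^sup>2 \<le> inner (xmin \<alpha>) x" using assms(1,2) by simp
  then have "(norm (xmin \<alpha> - x))\<^sup>2 \<le> 0"
    using eq unfolding x_def power2_norm_eq_inner norm_eq
    by (simp add: inner_diff_left inner_diff_right inner_commute)
  then have same: "xmin \<alpha> = x" by simp
  have x: "x \<in> eucl d" using xmin_in_eucl[OF assms(1)] by (simp add: x_def)
  let ?D = "inner (grad d F x) x"
  have stationary: "?D = - \<gamma> * (norm x)\<^sup>2" if \<gamma>: "\<gamma> > 0" "xmin \<gamma> = x" for \<gamma>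
  proof -
    have "((\<lambda>t. F (x + t *\<^sub>R x)) has_real_derivative ?D) (at 0)"
      by (rule has_real_derivative_along_line[OF grad_has_derivative(2)[OF diff x] x x])
    then have "((\<lambda>t. F (x + t *\<^sub>R x) + \<gamma> * (norm x)\<^sup>2 * t) has_real_derivative ?D + \<gamma> * (norm x)\<^sup>2) (at 0)"
      by (auto intro!: derivative_eq_intros)
    moreover have "F (x + 0 *\<^sub>R x) + \<gamma> * (norm x)\<^sup>2 * 0 \<le> F (x + t *\<^sub>R x) + \<gamma> * (norm x)\<^sup>2 * t" for t
    proof -
      have "x + t *\<^sub>R x \<in> eucl d" using x subspace_eucl by (intro subspace_add subspace_scale)
      from xmin_subgradient[OF \<gamma>(1) this] \<gamma>(2) show ?thesis
        by (simp add: power2_norm_eq_inner algebra_simps)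
    qed
    ultimately have "?D + \<gamma> * (norm x)\<^sup>2 = 0"
      by (intro DERIV_local_min[OF _ zero_less_one,
            where f = "\<lambda>t. F (x + t *\<^sub>R x) + \<gamma> * (norm x)\<^sup>2 * t" and x = 0]) blast+
    then show ?thesis by simp
  qed
  have "- \<alpha> * (norm x)\<^sup>2 = - \<beta> * (norm x)\<^sup>2"
    using stationary[OF assms(2) same] stationary[OF assms(1)] by (simp add: x_def)
  then show ?thesis using pos by (simp add: x_def)
qed

text \<open>
  The two opposite monotonicities make the norm locally Lipschitz in \<open>\<alpha>\<close>.
\<close>

lemma continuous_on_norm_xmin:
  assumes "b > 0"
  shows "continuous_on {b..} (\<lambda>\<alpha>. norm (xmin \<alpha>))"
proof -
  define C where "C = L / b\<^sup>2"
  have C: "C \<ge> 0" using L_nonneg by (simp add: C_def)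
  have bound: "\<bar>norm (xmin \<alpha>) - norm (xmin \<beta>)\<bar> \<le> C * (\<alpha> - \<beta>)" if ab: "b \<le> \<beta>" "\<beta> \<le> \<alpha>" for \<alpha> \<beta>
  proof -
    have pos: "0 < \<beta>" "0 < \<alpha>" using assms ab by auto
    have "b * norm (xmin \<beta>) \<le> \<beta> * norm (xmin \<beta>)" using ab by (intro mult_right_mono) auto
    then have n: "norm (xmin \<beta>) \<le> L / b" using norm_xmin_le[OF pos(1)] assms by (simp add: field_simps)
    have "b * (norm (xmin \<beta>) - norm (xmin \<alpha>)) \<le> \<alpha> * (norm (xmin \<beta>) - norm (xmin \<alpha>))"
      using norm_xmin_antimono[OF pos(1) ab(2)] ab by (intro mult_right_mono) auto
    also have "\<dots> \<le> (\<alpha> - \<beta>) * norm (xmin \<beta>)"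
      using scaled_norm_xmin_mono[OF pos(1) ab(2)] by (simp add: algebra_simps)
    also have "\<dots> \<le> (\<alpha> - \<beta>) * (L / b)" using n ab by (intro mult_left_mono) auto
    finally have "norm (xmin \<beta>) - norm (xmin \<alpha>) \<le> C * (\<alpha> - \<beta>)"
      using assms by (simp add: C_def field_simps power2_eq_square)
    then show ?thesis using norm_xmin_antimono[OF pos(1) ab(2)] by linarith
  qed
  have "C-lipschitz_on {b..} (\<lambda>\<alpha>. norm (xmin \<alpha>))"
  proof (rule lipschitz_onI)
    fix \<alpha> \<beta> assume "\<alpha> \<in> {b..}" "\<beta> \<in> {b..}"
    then show "dist (norm (xmin \<alpha>)) (norm (xmin \<beta>)) \<le> C * dist \<alpha> \<beta>"
      using bound[of \<beta> \<alpha>] bound[of \<alpha> \<beta>] by (cases "\<beta> \<le> \<alpha>") (auto simp: dist_real_def abs_minus_commute)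
  qed (rule C)
  then show ?thesis by (rule lipschitz_on_continuous_on)
qed

text \<open>
  The value \<open>t\<close> is attained by the intermediate value theorem, since for large parameters the norm is
  at most \<open>L / \<alpha>\<close>.
\<close>

lemma alpha_at:
  assumes "lam > 0" "t > 0" "norm (xmin (2 * lam)) \<ge> t"
  shows "2 * lam \<le> alpha_at d F lam t" "norm (xmin (alpha_at d F lam t)) = t"
proof -
  define M where "M = 2 * lam + L / t"
  have M: "M \<ge> 2 * lam" "M > 0" using L_nonneg assms by (auto simp: M_def add_pos_nonneg)
  have "t * norm (xmin M) * M \<le> t * L"
    using norm_xmin_le[OF M(2)] assms by (simp add: mult.commute mult.left_commute)
  also have "t * L \<le> t * t * M" using assms by (simp add: M_def field_simps)
  finally have "norm (xmin M) \<le> t" using assms(2) M by (simp add: mult.assoc)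
  then obtain \<alpha> where \<alpha>: "2 * lam \<le> \<alpha>" "norm (xmin \<alpha>) = t"
    using IVT2'[of "\<lambda>\<alpha>. norm (xmin \<alpha>)" M t "2 * lam"] assms M
      continuous_on_subset[OF continuous_on_norm_xmin[of "2 * lam"], of "{2 * lam..M}"] by auto
  have "\<exists>!\<alpha>. 2 * lam \<le> \<alpha> \<and> norm (xmin \<alpha>) = t"
    using \<alpha> norm_xmin_inj assms
    by (intro ex1I[of _ \<alpha>]) (auto intro!: norm_xmin_inj)
  from theI'[OF this, folded alpha_at_def]
  show "2 * lam \<le> alpha_at d F lam t" "norm (xmin (alpha_at d F lam t)) = t" by auto
qed

text \<open>
  Whatever phase one delivers, a bound on the norm of the minimiser is enough for the guarantee of
  the phase-two oracle to apply.
\<close>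

lemma phase_two_threshold_le:
  assumes "lam > 0" "r > 0" "2 * lam \<le> \<alpha>" and small: "norm (xmin \<alpha>) < 3 * r"
  shows "phase_two_threshold d F lam r \<le> \<alpha>"
proof (cases "norm (xmin (2 * lam)) < 3 * r")
  case False
  note a = alpha_at[of lam "3 * r"]
  have "alpha_at d F lam (3 * r) \<le> \<alpha>"
  proof (rule ccontr)
    assume "\<not> ?thesis"
    then have "3 * r \<le> norm (xmin \<alpha>)"
      using norm_xmin_antimono[of \<alpha> "alpha_at d F lam (3 * r)"] a assms False by auto
    with small show False by simp
  qed
  with False assms show ?thesis by (simp add: phase_two_threshold_def)
qed (use assms in \<open>simp add: phase_two_threshold_def\<close>)

end


section \<open>Geometric bisection\<close>

text \<open>
  Replacing either end of the interval by the geometric mean takes the square root of the ratio of its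
  ends, which is why powers \<open>c ^ 2 ^ k\<close> measure the number of steps.
\<close>

lemma sqrt_mult_between:
  fixes l u :: real
  assumes "0 < l" "l \<le> u"
  defines "m \<equiv> sqrt (u * l)"
  shows "l \<le> m" "m \<le> u" "u / m = sqrt (u / l)" "m / l = sqrt (u / l)"
proof -
  have "l * l \<le> u * l" "u * l \<le> u * u" using assms by (auto intro: mult_mono)
  then show "l \<le> m" "m \<le> u"
    unfolding m_def using assms by (auto simp: power2_eq_square intro: real_le_rsqrt real_le_lsqrt)
  have "u = sqrt u * sqrt u" "l = sqrt l * sqrt l" "sqrt u > 0" "sqrt l > 0" using assms by auto
  then show "u / m = sqrt (u / l)" "m / l = sqrt (u / l)"
    unfolding m_def real_sqrt_mult real_sqrt_divide by (metis nonzero_mult_divide_mult_cancel_left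
      nonzero_mult_divide_mult_cancel_right less_irrefl mult.commute)+
qed

lemma sqrt_le_power_halved:
  fixes c q :: real
  assumes "q \<le> c ^ 2 ^ Suc k" "0 \<le> c"
  shows "sqrt q \<le> c ^ 2 ^ k"
  using assms by (intro real_le_lsqrt) (simp_all add: power_mult[symmetric] mult.commute)

text \<open>
  The loop only replaces \<open>u\<close> by points where the oracle has norm at most \<open>r\<close> and \<open>l\<close> by points
  where it has norm above \<open>r\<close>. At the initial \<open>l\<close> nothing is known, hence the alternative \<open>l' = l\<close>.
\<close>

lemma bisection_two_terminates:
  assumes "0 < l" "l \<le> u" "0 < tol" "u / l \<le> (1 + tol) ^ 2 ^ k" "norm (O2 u) \<le> r"
  shows "\<exists>l' u' n'. bisection_two O2 r tol l u n = Some (l', u', n') \<and> n' \<le> n + k \<and>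
    l \<le> l' \<and> l' \<le> u' \<and> u' / l' \<le> 1 + tol \<and> norm (O2 u') \<le> r \<and> (l' = l \<or> norm (O2 l') > r)"
  using assms
proof (induction k arbitrary: l u n)
  case 0
  then show ?case by (subst bisection_two.simps) simp
next
  case (Suc k)
  define m where "m = sqrt (u * l)"
  note m = sqrt_mult_between[OF Suc.prems(1,2), folded m_def]
  have ratio: "u / m \<le> (1 + tol) ^ 2 ^ k" "m / l \<le> (1 + tol) ^ 2 ^ k"
    using sqrt_le_power_halved[OF Suc.prems(4)] Suc.prems(3) by (simp_all add: m)
  consider "u / l \<le> 1 + tol" | "u / l > 1 + tol" "norm (O2 m) > r" | "u / l > 1 + tol" "norm (O2 m) \<le> r"
    by linarith
  then show ?case
  proof cases
    case 1
    then show ?thesis using Suc.prems by (subst bisection_two.simps) simp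
  next
    case 2
    then have "bisection_two O2 r tol l u n = bisection_two O2 r tol m u (n + 1)"
      by (subst bisection_two.simps) (simp add: m_def Let_def)
    moreover from Suc.IH[of m u "n + 1"] obtain l' u' n' where
      "bisection_two O2 r tol m u (n + 1) = Some (l', u', n') \<and> n' \<le> n + 1 + k \<and>
        m \<le> l' \<and> l' \<le> u' \<and> u' / l' \<le> 1 + tol \<and> norm (O2 u') \<le> r \<and> (l' = m \<or> norm (O2 l') > r)"
      using Suc.prems m ratio by auto
    ultimately show ?thesis using 2 m(1) by auto
  next
    case 3
    then have "bisection_two O2 r tol l u n = bisection_two O2 r tol l m (n + 1)"
      by (subst bisection_two.simps) (simp add: m_def Let_def)
    moreover from Suc.IH[of l m "n + 1"] obtain l' u' n' where
      "bisection_two O2 r tol l m (n + 1) = Some (l', u', n') \<and> n' \<le> n + 1 + k \<and>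
        l \<le> l' \<and> l' \<le> u' \<and> u' / l' \<le> 1 + tol \<and> norm (O2 u') \<le> r \<and> (l' = l \<or> norm (O2 l') > r)"
      using Suc.prems m ratio 3 by auto
    ultimately show ?thesis by auto
  qed
qed

lemma ex_power_of_two_ge:
  fixes a :: real
  obtains k :: nat where "a \<le> 2 ^ k" "real k \<le> 1 + 2 * max 0 (ln a)"
proof (cases "a \<le> 1")
  case True
  then show ?thesis using that[of 0] by simp
next
  case False
  define k where "k = nat \<lceil>log 2 a\<rceil>"
  have pos: "log 2 a > 0" "ln a > 0" using False by auto
  have k: "log 2 a \<le> k" "real k \<le> log 2 a + 1" using pos unfolding k_def by linarith+
  have "a = 2 powr (log 2 a)" using False by simp
  also have "\<dots> \<le> 2 powr k" using k(1) by (intro powr_mono) auto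
  finally have "a \<le> 2 ^ k" by (simp add: powr_realpow)
  moreover have "log 2 a \<le> 2 * ln a"
    using ln2_ge_two_thirds pos by (simp add: log_def field_simps)
  ultimately show ?thesis using that[of k] k(2) pos by simp
qed


section \<open>The two phases of the search\<close>

locale oracle_search = smooth_convex +
  fixes lam r \<Delta> :: real and O1 O2 :: "real \<Rightarrow> fvec"
  assumes lam_pos: "lam > 0" and r_pos: "r > 0" and \<Delta>_pos: "\<Delta> > 0"
    and \<Delta>_le: "\<Delta> \<le> lam * r\<^sup>2 / 100"
    and O1: "phase_one_oracle d F r (2 * lam) O1"
    and O2: "phase_two_oracle d F (\<Delta> / 2) r (phase_two_threshold d F lam r) O2"
begin

text \<open>
  The oracle's error bound as inequalities between norms, with denominators cleared for linear
  arithmetic.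
\<close>

lemma norm_O1:
  assumes "2 * lam \<le> \<alpha>"
  shows "99 * norm (xmin \<alpha>) - r \<le> 100 * norm (O1 \<alpha>)" "100 * norm (O1 \<alpha>) \<le> 101 * norm (xmin \<alpha>) + r"
proof -
  have "norm (O1 \<alpha> - xmin \<alpha>) \<le> (r + norm (xmin \<alpha>)) / 100"
    using O1 assms by (simp add: phase_one_oracle_def)
  moreover have "\<bar>norm (O1 \<alpha>) - norm (xmin \<alpha>)\<bar> \<le> norm (O1 \<alpha> - xmin \<alpha>)"
    by (rule norm_triangle_ineq3)
  ultimately have "\<bar>norm (O1 \<alpha>) - norm (xmin \<alpha>)\<bar> \<le> (r + norm (xmin \<alpha>)) / 100" by linarith
  then show "99 * norm (xmin \<alpha>) - r \<le> 100 * norm (O1 \<alpha>)"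
    "100 * norm (O1 \<alpha>) \<le> 101 * norm (xmin \<alpha>) + r" unfolding abs_le_iff by argo+
qed

lemma norm_xmin_le_fraction:
  assumes "L / r \<le> c * \<alpha>" "0 < \<alpha>"
  shows "norm (xmin \<alpha>) \<le> c * r"
proof -
  have "\<alpha> * norm (xmin \<alpha>) \<le> L" by (rule norm_xmin_le[OF assms(2)])
  also have "L \<le> \<alpha> * (c * r)" using assms r_pos by (simp add: field_simps)
  finally show ?thesis using assms(2) by (simp only: mult_le_cancel_left_pos)
qed

text \<open>
  Once \<open>u \<ge> L / r\<close> the minimiser has norm at most \<open>r\<close>, and the oracle's error is too small to hide
  this. The last conjunct supplies the lower end of the interval for the bisection.
\<close>

lemma doubling_terminates:
  assumes "2 * lam \<le> u" "L / r \<le> u * 2 ^ k"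
  shows "\<exists>j\<le>k. doubling O1 r u n = Some (u * 2 ^ j, n + j + 1) \<and>
    norm (O1 (u * 2 ^ j)) \<le> 5/2 * r \<and> (j > 0 \<longrightarrow> 5/2 * r < norm (O1 (u * 2 ^ j / 2)))"
  using assms
proof (induction k arbitrary: u n)
  case 0
  have "norm (xmin u) \<le> r" using norm_xmin_le_fraction[of 1 u] 0 lam_pos by simp
  then have "norm (O1 u) \<le> 5/2 * r" using norm_O1[OF 0(1)] r_pos by linarith
  then show ?case by (subst doubling.simps) simp
next
  case (Suc k)
  show ?case
  proof (cases "norm (O1 u) > 5/2 * r")
    case False
    then show ?thesis by (intro exI[of _ 0]) (subst doubling.simps, simp)
  next
    case True
    have "\<exists>j\<le>k. doubling O1 r (2 * u) (n + 1) = Some (2 * u * 2 ^ j, n + 1 + j + 1) \<and>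
        norm (O1 (2 * u * 2 ^ j)) \<le> 5/2 * r \<and> (j > 0 \<longrightarrow> 5/2 * r < norm (O1 (2 * u * 2 ^ j / 2)))"
      using Suc.prems lam_pos by (intro Suc.IH) (auto simp: mult.commute)
    then obtain j where j: "j \<le> k"
      "doubling O1 r (2 * u) (n + 1) = Some (2 * u * 2 ^ j, n + 1 + j + 1)"
      "norm (O1 (2 * u * 2 ^ j)) \<le> 5/2 * r" "j > 0 \<longrightarrow> 5/2 * r < norm (O1 (2 * u * 2 ^ j / 2))"
      by blast
    have "5/2 * r < norm (O1 (u * 2 ^ Suc j / 2))"
      using True j(4) by (cases "j = 0") (simp_all add: mult.commute mult.left_commute)
    moreover have "doubling O1 r u n = Some (u * 2 ^ Suc j, n + Suc j + 1)"
      using True j(2) by (subst doubling.simps) (simp add: mult.commute mult.left_commute)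
    ultimately show ?thesis using j(1,3)
      by (intro exI[of _ "Suc j"]) (simp add: mult_ac)
  qed
qed

text \<open>
  The norm cannot drop by a larger factor than the parameter grows.
\<close>

lemma ratio_gt_of_norm_ratio_gt:
  assumes "0 < l" "l \<le> u" "0 < c" "c * norm (xmin u) < norm (xmin l)"
  shows "c < u / l"
proof -
  have "l * (c * norm (xmin u)) < l * norm (xmin l)"
    using assms by (intro mult_strict_left_mono)
  also have "\<dots> \<le> u * norm (xmin u)" by (rule scaled_norm_xmin_mono[OF assms(1,2)])
  finally have "(l * c) * norm (xmin u) < u * norm (xmin u)" by (simp add: mult.assoc)
  then have "l * c < u" by (metis mult_less_cancel_right norm_ge_zero not_le)
  then show ?thesis using assms(1) by (simp add: field_simps)
qed

text \<open>
  A failed step replaces one end by a point at which the oracle has norm outside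
  \<open>{21/10 * r..29/10 * r}\<close>, while at the other end it is on the opposite side of \<open>5/2 * r\<close>.
  Allowing for the error of the oracle, the norms of the two minimisers still differ by a factor of at
  least \<open>(29/10 - 1/100) / (101/100)\<close> to \<open>(5/2 + 1/100) / (99/100)\<close>, which exceeds \<open>28/25\<close>.
\<close>

lemma bisection_one_step:
  assumes "2 * lam \<le> l" "l \<le> u" "5/2 * r < norm (O1 l)" "norm (O1 u) \<le> 5/2 * r"
  obtains m where "2 * lam \<le> m" "norm (O1 m) \<in> {21/10 * r..29/10 * r}"
    "bisection_one O1 r l u n = Some (m, n + 1)"
  | l' u' where "2 * lam \<le> l'" "l' \<le> u'" "5/2 * r < norm (O1 l')" "norm (O1 u') \<le> 5/2 * r"
    "u' / l' = sqrt (u / l)" "28/25 < u' / l'"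
    "bisection_one O1 r l u n = bisection_one O1 r l' u' (n + 2)"
proof -
  define m where "m = sqrt (u * l)"
  have l: "0 < l" using assms(1) lam_pos by simp
  note m = sqrt_mult_between[OF l assms(2), folded m_def]
  have ge: "2 * lam \<le> u" "2 * lam \<le> m" using assms(1,2) m(1) by auto
  note bounds = norm_O1[OF assms(1)] norm_O1[OF ge(1)] norm_O1[OF ge(2)]
  consider "norm (O1 m) \<in> {21/10 * r..29/10 * r}" | "29/10 * r < norm (O1 m)" | "norm (O1 m) < 21/10 * r"
    by fastforce
  then show ?thesis
  proof cases
    case 1
    then have "bisection_one O1 r l u n = Some (m, n + 1)"
      by (subst bisection_one.simps) (simp add: m_def Let_def)
    then show ?thesis using that(1) ge(2) 1 by blast
  next
    case 2
    have "28/25 * norm (xmin u) < norm (xmin m)" using 2 assms(4) bounds r_pos by linarith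
    then have "28/25 < u / m" using ge lam_pos m by (intro ratio_gt_of_norm_ratio_gt[where c = "28/25"]) linarith+
    moreover have "bisection_one O1 r l u n = bisection_one O1 r m u (n + 2)"
      using 2 by (subst bisection_one.simps) (simp add: m_def Let_def)
    ultimately show ?thesis using that(2)[of m u] 2 assms ge m r_pos by auto
  next
    case 3
    have "28/25 * norm (xmin m) < norm (xmin l)" using 3 assms(3) bounds r_pos by linarith
    then have "28/25 < m / l" using l m by (intro ratio_gt_of_norm_ratio_gt[where c = "28/25"]) linarith+
    moreover have "bisection_one O1 r l u n = bisection_one O1 r l m (n + 2)"
      using 3 r_pos by (subst bisection_one.simps) (simp add: m_def Let_def)
    ultimately show ?thesis using that(2)[of l m] 3 assms ge m r_pos by auto
  qed
qed

text \<open>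
  The invariant \<open>28/25 < u / l\<close> contradicts \<open>u / l \<le> 28/25\<close>, which would hold after \<open>k + 1\<close> failed
  steps. Each failed step calls the oracle twice and the successful one once.
\<close>

lemma bisection_one_terminates:
  assumes "2 * lam \<le> l" "l \<le> u" "5/2 * r < norm (O1 l)" "norm (O1 u) \<le> 5/2 * r"
    "u / l \<le> (28/25) ^ 2 ^ Suc k"
  shows "\<exists>m n'. bisection_one O1 r l u n = Some (m, n') \<and> n' \<le> n + 2 * k + 1 \<and>
    2 * lam \<le> m \<and> norm (O1 m) \<in> {21/10 * r..29/10 * r}"
  using assms
proof (induction k arbitrary: l u n)
  case 0
  from 0(1-4) show ?case
  proof (cases rule: bisection_one_step[where n = n])
    case (2 l' u')
    then show ?thesis using sqrt_le_power_halved[OF 0(5)] by simp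
  qed auto
next
  case (Suc k)
  from Suc.prems(1-4) show ?case
  proof (cases rule: bisection_one_step[where n = n])
    case (2 l' u')
    have "u' / l' \<le> (28/25) ^ 2 ^ Suc k" using sqrt_le_power_halved[OF Suc.prems(5)] 2(5) by simp
    from Suc.IH[OF 2(1-4) this, of "n + 2"] show ?thesis unfolding 2(7) by auto
  qed auto
qed

text \<open>
  The upper bound on the norm makes the phase-two oracle reliable from \<open>\<alpha>\<close> on. The lower bound is
  what makes \<open>\<alpha>\<close> a valid lower end for phase two, unless \<open>\<alpha>\<close> is the smallest parameter.
\<close>

lemma phase_one_correct:
  obtains \<alpha> n where "phase_one lam r O1 = Some (\<alpha>, n)" "2 * lam \<le> \<alpha>" "norm (xmin \<alpha>) < 3 * r"
    "\<alpha> = 2 * lam \<or> 2 * r < norm (xmin \<alpha>)" "real n \<le> 9 * max 1 (ln (L / (lam * r)))"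
proof -
  obtain k where k: "L / (lam * r) \<le> 2 ^ k" "real k \<le> 1 + 2 * max 0 (ln (L / (lam * r)))"
    by (rule ex_power_of_two_ge)
  have "L / r \<le> lam * 2 ^ k" using k(1) lam_pos r_pos by (simp add: field_simps)
  also have "\<dots> \<le> 2 * lam * 2 ^ k" using lam_pos by simp
  finally obtain j where j: "j \<le> k"
    "doubling O1 r (2 * lam) 0 = Some (2 * lam * 2 ^ j, j + 1)"
    "norm (O1 (2 * lam * 2 ^ j)) \<le> 5/2 * r"
    "j > 0 \<longrightarrow> 5/2 * r < norm (O1 (2 * lam * 2 ^ j / 2))"
    using doubling_terminates[of "2 * lam" k 0] by auto
  have calls: "real n \<le> 9 * max 1 (ln (L / (lam * r)))" if "n \<le> j + 6" for n
    using that j(1) k(2) by linarith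
  show ?thesis
  proof (cases "j = 0")
    case True
    have "phase_one lam r O1 = Some (2 * lam, 1)" using True j(2) by (simp add: phase_one_def)
    moreover have "norm (xmin (2 * lam)) < 3 * r"
      using True j(3) norm_O1[of "2 * lam"] r_pos by simp
    ultimately show ?thesis using calls[of 1] by (intro that[of "2 * lam" 1]) auto
  next
    case False
    define u where "u = 2 * lam * 2 ^ j"
    have "(2::real) ^ 1 \<le> 2 ^ j" using False by (intro power_increasing) auto
    then have u: "2 * lam \<le> u / 2" "u \<noteq> 2 * lam" using lam_pos by (auto simp: u_def)
    \<comment> \<open>The initial ratio is 2, which is at most \<open>(28/25) ^ 8\<close>: two failed steps at most.\<close>
    have "\<exists>m n'. bisection_one O1 r (u / 2) u (j + 1) = Some (m, n') \<and> n' \<le> j + 1 + 2 * 2 + 1 \<and>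
        2 * lam \<le> m \<and> norm (O1 m) \<in> {21/10 * r..29/10 * r}"
      using u lam_pos j(3,4) False
      by (intro bisection_one_terminates) (auto simp: u_def power_divide)
    then obtain m n where m: "bisection_one O1 r (u / 2) u (j + 1) = Some (m, n)" "n \<le> j + 6"
      "2 * lam \<le> m" "norm (O1 m) \<in> {21/10 * r..29/10 * r}" by auto
    have "phase_one lam r O1 = Some (m, n)"
      using j(2) m(1) u(2) by (simp add: phase_one_def u_def[symmetric])
    moreover have "norm (xmin m) < 3 * r" "2 * r < norm (xmin m)"
      using m(4) norm_O1[OF m(3)] r_pos by auto
    ultimately show ?thesis using m calls by (intro that[of m n]) auto
  qed
qed

definition tol :: real where "tol = \<Delta> / (10 * (L * r + lam * r\<^sup>2))"

lemma tol_pos: "0 < tol"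
  and tol_mult: "tol * (L * r + lam * r\<^sup>2) = \<Delta> / 10"
proof -
  have "0 < L * r + lam * r\<^sup>2" using L_nonneg lam_pos r_pos by (intro add_nonneg_pos) auto
  moreover have "0 < \<Delta> / (10 * S)" "\<Delta> / (10 * S) * S = \<Delta> / 10" if "0 < S" for S using that \<Delta>_pos by simp_all
  ultimately show "0 < tol" "tol * (L * r + lam * r\<^sup>2) = \<Delta> / 10"
    using \<Delta>_pos unfolding tol_def by blast+
qed

lemma tol_mult_lam: "tol * (lam * r\<^sup>2) \<le> \<Delta> / 10"
  and tol_mult_L: "tol * (L * r) \<le> \<Delta> / 10"
proof -
  have "0 \<le> tol * (lam * r\<^sup>2)" "0 \<le> tol * (L * r)"
    using tol_pos L_nonneg lam_pos r_pos by auto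
  then show "tol * (lam * r\<^sup>2) \<le> \<Delta> / 10" "tol * (L * r) \<le> \<Delta> / 10"
    using tol_mult by (simp_all add: distrib_left)
qed

text \<open>
  With \<open>Q = (L * r + lam * r\<^sup>2) / \<Delta>\<close> the tolerance is \<open>1 / (10 * Q)\<close>. As \<open>\<Delta>\<close> is at most
  \<open>lam * r\<^sup>2 / 100\<close>, also \<open>L / (lam * r) \<le> Q / 100\<close>, so \<open>2 ^ k \<ge> Q\<^sup>2\<close> is enough by Bernoulli's
  inequality. The same bound on \<open>\<Delta>\<close> gives \<open>Q \<ge> 100\<close>, which absorbs the additive constants.
\<close>

lemma tol_power_ge:
  obtains k :: nat where "1 + 2 * L / (lam * r) \<le> (1 + tol) ^ 2 ^ k"
    "real (k + 2) \<le> 7 * ln ((L * r + lam * r\<^sup>2) / \<Delta>)"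
proof -
  define S where "S = L * r + lam * r\<^sup>2"
  define Q where "Q = S / \<Delta>"
  have "100 * \<Delta> \<le> lam * r\<^sup>2" using \<Delta>_le by simp
  then have "100 * \<Delta> \<le> S" using L_nonneg r_pos by (simp add: S_def add_increasing)
  then have Q: "Q \<ge> 100" using \<Delta>_pos by (simp add: Q_def field_simps)
  have tol: "tol = 1 / (10 * Q)" by (simp add: tol_def Q_def S_def)
  obtain k where k: "Q\<^sup>2 \<le> 2 ^ k" "real k \<le> 1 + 2 * max 0 (ln (Q\<^sup>2))" by (rule ex_power_of_two_ge)
  have "L / (lam * r) = L * r / (lam * r\<^sup>2)" using r_pos by (simp add: power2_eq_square)
  also have "\<dots> \<le> L * r / (100 * \<Delta>)"
    using \<open>100 * \<Delta> \<le> lam * r\<^sup>2\<close> \<Delta>_pos lam_pos r_pos L_nonneg by (intro divide_left_mono) auto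
  also have "\<dots> \<le> S / (100 * \<Delta>)"
    using \<Delta>_pos lam_pos by (intro divide_right_mono) (auto simp: S_def)
  finally have "2 * (L / (lam * r)) \<le> 2 * (Q / 100)" by (simp add: Q_def)
  then have "2 * L / (lam * r) \<le> 2 * Q / 100" by simp
  also have "\<dots> \<le> Q\<^sup>2 / (10 * Q)" using Q by (simp add: power2_eq_square)
  also have "\<dots> \<le> 2 ^ k * tol" using k(1) Q by (simp add: tol divide_right_mono)
  also have "1 + 2 ^ k * tol \<le> (1 + tol) ^ 2 ^ k"
    using Bernoulli_inequality[of tol "2 ^ k"] tol_pos by simp
  finally have "1 + 2 * L / (lam * r) \<le> (1 + tol) ^ 2 ^ k" by simp
  moreover have "exp 1 \<le> Q" using exp_le Q by linarith
  then have "ln Q \<ge> 1" using Q by (subst ln_ge_iff) auto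
  then have "real (k + 2) \<le> 7 * ln Q" using k(2) Q by (simp add: ln_realpow)
  ultimately show ?thesis using that[of k] by (simp add: Q_def S_def)
qed

end

locale phase_two_search = oracle_search +
  fixes \<alpha>' :: real
  assumes \<alpha>'_ge: "2 * lam \<le> \<alpha>'" and norm_xmin_\<alpha>': "norm (xmin \<alpha>') < 3 * r"
begin

lemma \<alpha>'_pos: "0 < \<alpha>'"
  using \<alpha>'_ge lam_pos by simp

lemma O2_guarantee:
  assumes "\<alpha>' \<le> \<alpha>"
  shows "O2 \<alpha> \<in> eucl d"
    "F (O2 \<alpha>) + \<alpha> / 2 * (norm (O2 \<alpha>))\<^sup>2 \<le> F (xmin \<alpha>) + \<alpha> / 2 * (norm (xmin \<alpha>))\<^sup>2 + \<Delta> / 2"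
  using O2 phase_two_threshold_le[OF lam_pos r_pos \<alpha>'_ge norm_xmin_\<alpha>'] assms
  by (auto simp: phase_two_oracle_def)

text \<open>
  By quadratic growth, near-optimality implies closeness to the minimiser; here \<open>\<Delta>\<close> is small
  compared with \<open>lam * r\<^sup>2\<close>.
\<close>

lemma norm_O2_diff_le:
  assumes "\<alpha>' \<le> \<alpha>"
  shows "\<bar>norm (O2 \<alpha>) - norm (xmin \<alpha>)\<bar> \<le> r / 10"
proof -
  have \<alpha>: "\<alpha> > 0" "lam \<le> \<alpha> / 2" using assms \<alpha>'_ge lam_pos by auto
  let ?e = "norm (O2 \<alpha> - xmin \<alpha>)"
  have "lam * ?e\<^sup>2 \<le> \<alpha> / 2 * ?e\<^sup>2" using \<alpha>(2) by (intro mult_right_mono) auto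
  also have "\<dots> \<le> \<Delta> / 2"
    using xmin_quadratic_growth[OF \<alpha>(1) O2_guarantee(1)[OF assms]] O2_guarantee(2)[OF assms]
    by linarith
  also have "\<dots> \<le> lam * (r / 10)\<^sup>2"
    using \<Delta>_le \<Delta>_pos by (simp add: power_divide)
  finally have "?e\<^sup>2 \<le> (r / 10)\<^sup>2" using lam_pos by (simp only: mult_le_cancel_left_pos)
  then have "?e \<le> r / 10" by (rule power2_le_imp_le) (use r_pos in simp)
  then show ?thesis by (rule order_trans[OF norm_triangle_ineq3])
qed

text \<open>
  On the ball, the regularisers with parameters \<open>u\<close> and \<open>2 * lam\<close> differ by at most
  \<open>tol * lam * r\<^sup>2\<close>.
\<close>

lemma boundary_nearly_optimal:
  assumes u: "2 * lam \<le> u" "\<alpha>' \<le> u" "u / (2 * lam) \<le> 1 + tol"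
    and y: "y \<in> eucl d" "norm y \<le> r"
  shows "F (O2 u) + lam * (norm (O2 u))\<^sup>2 \<le> F y + lam * (norm y)\<^sup>2 + \<Delta>"
proof -
  have "lam * (norm (O2 u))\<^sup>2 \<le> u / 2 * (norm (O2 u))\<^sup>2"
    using u(1) by (intro mult_right_mono) auto
  moreover have "F (xmin u) + u / 2 * (norm (xmin u))\<^sup>2 \<le> F y + u / 2 * (norm y)\<^sup>2"
    using u(1) lam_pos y by (intro xmin_le) auto
  moreover have "(u / 2 - lam) * (norm y)\<^sup>2 \<le> (lam * tol) * r\<^sup>2"
    using u y(2) lam_pos tol_pos by (intro mult_mono power_mono) (auto simp: field_simps)
  ultimately show ?thesis
    using O2_guarantee(2)[OF u(2)] tol_mult_lam \<Delta>_pos by (simp add: algebra_simps)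
qed

text \<open>
  Let \<open>G\<close> be the objective regularised with \<open>l\<close>. Passing from \<open>u\<close> to \<open>l\<close> costs
  \<open>(u - l) / 2 * (norm (xmin l))\<^sup>2\<close>, which the tolerance keeps below \<open>\<Delta> / 2\<close> because
  \<open>l * norm (xmin l) \<le> L\<close> and \<open>norm (xmin l) < 3 * r\<close>. So both end points, and by convexity
  \<open>x\<close>, minimise \<open>G\<close> up to \<open>\<Delta>\<close>. Going back from \<open>G\<close> to the original objective subtracts a
  multiple of the squared norm, which at \<open>x\<close> is as large as anywhere in the ball.
\<close>

lemma interpolation_nearly_optimal:
  assumes l: "2 * lam \<le> l" "\<alpha>' \<le> l" "l \<le> u" "u / l \<le> 1 + tol"
    and t: "t \<in> {0..1}" and x: "x = (1 - t) *\<^sub>R O2 l + t *\<^sub>R O2 u" "norm x = r"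
    and y: "y \<in> eucl d" "norm y \<le> r"
  shows "F x + lam * (norm x)\<^sup>2 \<le> F y + lam * (norm y)\<^sup>2 + \<Delta>"
proof -
  define G where "G z = F z + l / 2 * (norm z)\<^sup>2" for z
  have pos: "0 < l" "0 < u" using l lam_pos by auto
  have O2_mem: "O2 l \<in> eucl d" "O2 u \<in> eucl d" using O2_guarantee(1) l by auto
  have G1: "G (O2 l) \<le> G (xmin l) + \<Delta>"
    using O2_guarantee(2)[OF l(2)] \<Delta>_pos by (simp add: G_def)
  have G2: "G (O2 u) \<le> G (xmin l) + \<Delta>"
  proof -
    have "l * norm (xmin l) * norm (xmin l) \<le> L * (3 * r)"
      using norm_xmin_le[OF pos(1)] norm_xmin_antimono[OF \<alpha>'_pos l(2)] norm_xmin_\<alpha>' L_nonneg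
      by (intro mult_mono) auto
    then have "tol * (l * norm (xmin l) * norm (xmin l)) \<le> tol * (L * (3 * r))"
      using tol_pos by (intro mult_left_mono) auto
    moreover have "(u - l) * (norm (xmin l))\<^sup>2 \<le> (l * tol) * (norm (xmin l))\<^sup>2"
      using l(4) pos by (intro mult_right_mono) (auto simp: field_simps)
    ultimately have gap: "(u - l) / 2 * (norm (xmin l))\<^sup>2 \<le> \<Delta> / 2"
      using tol_mult_L \<Delta>_pos by (simp add: power2_eq_square algebra_simps)
    have "l / 2 * (norm (O2 u))\<^sup>2 \<le> u / 2 * (norm (O2 u))\<^sup>2"
      using l(3) by (intro mult_right_mono) auto
    moreover have "F (xmin u) + u / 2 * (norm (xmin u))\<^sup>2 \<le> F (xmin l) + u / 2 * (norm (xmin l))\<^sup>2"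
      using pos by (intro xmin_le xmin_in_eucl)
    moreover have "u / 2 * (norm (xmin l))\<^sup>2 =
        l / 2 * (norm (xmin l))\<^sup>2 + (u - l) / 2 * (norm (xmin l))\<^sup>2"
      by (simp add: field_simps)
    ultimately show ?thesis
      using O2_guarantee(2)[of u] l gap unfolding G_def by linarith
  qed
  have "F x \<le> (1 - t) * F (O2 l) + t * F (O2 u)"
    unfolding x(1) using convex O2_mem t by (intro convex_onD) auto
  moreover have "(norm x)\<^sup>2 \<le> (1 - t) * (norm (O2 l))\<^sup>2 + t * (norm (O2 u))\<^sup>2"
    unfolding x(1) power2_norm_convex_combination using t by simp
  then have "l / 2 * (norm x)\<^sup>2 \<le> l / 2 * ((1 - t) * (norm (O2 l))\<^sup>2 + t * (norm (O2 u))\<^sup>2)"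
    using pos by (intro mult_left_mono) auto
  ultimately have "G x \<le> (1 - t) * G (O2 l) + t * G (O2 u)"
    by (simp add: G_def field_simps)
  also have "\<dots> \<le> (1 - t) * (G (xmin l) + \<Delta>) + t * (G (xmin l) + \<Delta>)"
    using G1 G2 t by (intro add_mono mult_left_mono) auto
  also have "\<dots> = G (xmin l) + \<Delta>" by (simp add: algebra_simps)
  also have "G (xmin l) \<le> G y" unfolding G_def by (rule xmin_le[OF pos(1) y(1)])
  finally have "G x \<le> G y + \<Delta>" by simp
  moreover have "(l / 2 - lam) * (norm y)\<^sup>2 \<le> (l / 2 - lam) * (norm x)\<^sup>2"
    using l(1) x(2) y(2) by (intro mult_left_mono power_mono) auto
  ultimately show ?thesis by (simp add: G_def algebra_simps)
qed

text \<open>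
  If \<open>\<alpha>'\<close> is not the smallest parameter, its minimiser has norm above \<open>2 * r\<close>, so that
  \<open>\<alpha>' \<le> L / (2 * r)\<close> lies below the initial \<open>u\<close>, and the oracle at \<open>\<alpha>'\<close> still has norm above
  \<open>r\<close>. At the initial \<open>u\<close> the minimiser has norm at most \<open>r / 4\<close>.
\<close>

lemma phase_two_correct:
  assumes far: "\<alpha>' = 2 * lam \<or> 2 * r < norm (xmin \<alpha>')"
  obtains l u n where "bisection_two O2 r tol \<alpha>' (4 * L / r + 2 * lam) 0 = Some (l, u, n)"
    "real (n + 2) \<le> 7 * ln ((L * r + lam * r\<^sup>2) / \<Delta>)"
    "\<alpha>' \<le> l" "l \<le> u" "u / l \<le> 1 + tol" "norm (O2 u) \<le> r" "l = 2 * lam \<or> r < norm (O2 l)"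
proof -
  define u where "u = 4 * L / r + 2 * lam"
  define q where "q = L / r"
  have Lr: "0 \<le> q" and u_eq: "u = 4 * q + 2 * lam"
    using L_nonneg r_pos by (simp_all add: u_def q_def)
  have "\<alpha>' \<le> u"
  proof (cases "\<alpha>' = 2 * lam")
    case False
    with far have "\<alpha>' * (2 * r) \<le> \<alpha>' * norm (xmin \<alpha>')"
      using \<alpha>'_pos by (intro mult_left_mono) auto
    also have "\<dots> \<le> L" by (rule norm_xmin_le[OF \<alpha>'_pos])
    finally have "\<alpha>' \<le> q / 2" using r_pos by (simp add: q_def field_simps)
    with Lr lam_pos show ?thesis unfolding u_eq by linarith
  qed (use Lr in \<open>simp add: u_eq\<close>)
  have "norm (xmin u) \<le> 1 / 4 * r"
    using Lr lam_pos unfolding u_eq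
    by (intro norm_xmin_le_fraction[where c = "1 / 4"]) (simp_all flip: q_def add: field_simps)
  then have small: "norm (O2 u) \<le> r" using norm_O2_diff_le[OF \<open>\<alpha>' \<le> u\<close>] r_pos by linarith
  obtain k where k: "1 + 2 * L / (lam * r) \<le> (1 + tol) ^ 2 ^ k"
    "real (k + 2) \<le> 7 * ln ((L * r + lam * r\<^sup>2) / \<Delta>)" by (rule tol_power_ge)
  have "u / \<alpha>' \<le> u / (2 * lam)"
    using \<alpha>'_ge lam_pos \<alpha>'_pos \<open>\<alpha>' \<le> u\<close> by (intro divide_left_mono) auto
  also have "\<dots> = 1 + 2 * L / (lam * r)" using lam_pos r_pos by (simp add: u_def field_simps)
  finally have "u / \<alpha>' \<le> (1 + tol) ^ 2 ^ k" using k(1) by simp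
  from bisection_two_terminates[OF \<alpha>'_pos \<open>\<alpha>' \<le> u\<close> tol_pos this, of O2 r 0] small
  obtain l u' n where res: "bisection_two O2 r tol \<alpha>' u 0 = Some (l, u', n)" "n \<le> k" "\<alpha>' \<le> l" "l \<le> u'"
    "u' / l \<le> 1 + tol" "norm (O2 u') \<le> r" "l = \<alpha>' \<or> norm (O2 l) > r" by auto
  have "l = 2 * lam \<or> r < norm (O2 l)"
    using res(7) far norm_O2_diff_le[of \<alpha>'] r_pos by auto
  with res k(2) show ?thesis by (intro that[of l u' n]) (auto simp: u_def)
qed

end

context oracle_search
begin

text \<open>
  The loops determine everything except the final interpolation parameter, which exists by the
  intermediate value theorem because the norms at the two end points lie on either side of \<open>r\<close>.
\<close>

theorem binary_search_correct:
  shows "\<exists>x n1 n2. binary_search lam r \<Delta> L O1 O2 x n1 n2"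
    and "binary_search lam r \<Delta> L O1 O2 x n1 n2 \<Longrightarrow>
      x \<in> eucl d \<and> norm x \<le> r \<and>
      (\<forall>y\<in>eucl d. norm y \<le> r \<longrightarrow> F x + lam * (norm x)\<^sup>2 \<le> F y + lam * (norm y)\<^sup>2 + \<Delta>) \<and>
      real n1 \<le> 9 * max 1 (ln (L / (lam * r))) \<and>
      real n2 \<le> 7 * ln ((L * r + lam * r\<^sup>2) / \<Delta>)"
proof -
  obtain \<alpha>' k1 where one: "phase_one lam r O1 = Some (\<alpha>', k1)" "2 * lam \<le> \<alpha>'" "norm (xmin \<alpha>') < 3 * r"
    "\<alpha>' = 2 * lam \<or> 2 * r < norm (xmin \<alpha>')" "real k1 \<le> 9 * max 1 (ln (L / (lam * r)))"
    by (rule phase_one_correct)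
  interpret phase_two_search d F L lam r \<Delta> O1 O2 \<alpha>'
    using one by unfold_locales
  obtain l u k2 where two: "bisection_two O2 r tol \<alpha>' (4 * L / r + 2 * lam) 0 = Some (l, u, k2)"
    "real (k2 + 2) \<le> 7 * ln ((L * r + lam * r\<^sup>2) / \<Delta>)"
    "\<alpha>' \<le> l" "l \<le> u" "u / l \<le> 1 + tol" "norm (O2 u) \<le> r" "l = 2 * lam \<or> r < norm (O2 l)"
    using phase_two_correct[OF one(4)] by metis
  have O2_mem: "O2 l \<in> eucl d" "O2 u \<in> eucl d" using O2_guarantee(1) two by auto
  have run: "binary_search lam r \<Delta> L O1 O2 x n1 n2 \<longleftrightarrow> n1 = k1 \<and> n2 = k2 + 2 \<and>
      (if l = 2 * lam then x = O2 u
       else \<exists>t\<in>{0..1}. x = (1 - t) *\<^sub>R O2 l + t *\<^sub>R O2 u \<and> norm x = r)" for x n1 n2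
    unfolding binary_search_def tol_def[symmetric] using one(1) two(1) by auto
  have "\<exists>t\<in>{0..1}. norm ((1 - t) *\<^sub>R O2 l + t *\<^sub>R O2 u) = r" if "r < norm (O2 l)"
  proof -
    have "continuous_on {0..1} (\<lambda>t. norm ((1 - t) *\<^sub>R O2 l + t *\<^sub>R O2 u))"
      by (intro continuous_intros)
    then show ?thesis
      using IVT2'[of "\<lambda>t. norm ((1 - t) *\<^sub>R O2 l + t *\<^sub>R O2 u)" 1 r 0] that two(6) by auto
  qed
  then show "\<exists>x n1 n2. binary_search lam r \<Delta> L O1 O2 x n1 n2"
    unfolding run using two(7) by auto
  assume "binary_search lam r \<Delta> L O1 O2 x n1 n2"
  then have n: "n1 = k1" "n2 = k2 + 2" and
    x: "if l = 2 * lam then x = O2 u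
      else \<exists>t\<in>{0..1}. x = (1 - t) *\<^sub>R O2 l + t *\<^sub>R O2 u \<and> norm x = r"
    unfolding run by auto
  have "x \<in> eucl d \<and> norm x \<le> r \<and>
    (\<forall>y\<in>eucl d. norm y \<le> r \<longrightarrow> F x + lam * (norm x)\<^sup>2 \<le> F y + lam * (norm y)\<^sup>2 + \<Delta>)"
  proof (cases "l = 2 * lam")
    case True
    then show ?thesis using x O2_mem two one(2) boundary_nearly_optimal[of u] by auto
  next
    case False
    then obtain t where t: "t \<in> {0..1}" "x = (1 - t) *\<^sub>R O2 l + t *\<^sub>R O2 u" "norm x = r"
      using x by auto
    have "x \<in> eucl d" unfolding t(2) using O2_mem subspace_eucl by (intro subspace_add subspace_scale)
    then show ?thesis using t(3) one(2) two interpolation_nearly_optimal[OF _ _ _ _ t] by auto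
  qed
  with n one(5) two(2) show "x \<in> eucl d \<and> norm x \<le> r \<and>
      (\<forall>y\<in>eucl d. norm y \<le> r \<longrightarrow> F x + lam * (norm x)\<^sup>2 \<le> F y + lam * (norm y)\<^sup>2 + \<Delta>) \<and>
      real n1 \<le> 9 * max 1 (ln (L / (lam * r))) \<and>
      real n2 \<le> 7 * ln ((L * r + lam * r\<^sup>2) / \<Delta>)" by simp
qed

end

theorem proposition4:
  shows "\<exists>C1 C2 :: real. \<forall>(d :: nat) (F :: fvec \<Rightarrow> real) (L :: real) (lam :: real) (\<Delta> :: real) (r :: real)
      (O1 :: real \<Rightarrow> fvec) (O2 :: real \<Rightarrow> fvec).
    convex_on (eucl d) F \<longrightarrow> F differentiable_on eucl d \<longrightarrow> norm (grad d F 0) \<le> L \<longrightarrow>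
    lam > 0 \<longrightarrow> \<Delta> > 0 \<longrightarrow> r > 0 \<longrightarrow> \<Delta> \<le> lam * r\<^sup>2 / 100 \<longrightarrow>
    phase_one_oracle d F r (2 * lam) O1 \<longrightarrow>
    phase_two_oracle d F (\<Delta> / 2) r (phase_two_threshold d F lam r) O2 \<longrightarrow>
    (\<exists>x n1 n2. binary_search lam r \<Delta> L O1 O2 x n1 n2) \<and>
    (\<forall>x n1 n2. binary_search lam r \<Delta> L O1 O2 x n1 n2 \<longrightarrow>
      x \<in> eucl d \<and> norm x \<le> r \<and>
      F x + lam * (norm x)\<^sup>2 \<le> (INF y\<in>{y \<in> eucl d. norm y \<le> r}. F y + lam * (norm y)\<^sup>2) + \<Delta> \<and>
      real n1 \<le> C1 * max 1 (ln (L / (lam * r))) \<and>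
      real n2 \<le> C2 * ln ((L * r + lam * r\<^sup>2) / \<Delta>))"
proof (rule exI[of _ 9], rule exI[of _ 7], intro allI impI)
  fix d :: nat and F :: "fvec \<Rightarrow> real" and L lam \<Delta> r :: real and O1 O2 :: "real \<Rightarrow> fvec"
  assume "convex_on (eucl d) F" "F differentiable_on eucl d" "norm (grad d F 0) \<le> L" "lam > 0"
    "\<Delta> > 0" "r > 0" "\<Delta> \<le> lam * r\<^sup>2 / 100" "phase_one_oracle d F r (2 * lam) O1"
    "phase_two_oracle d F (\<Delta> / 2) r (phase_two_threshold d F lam r) O2"
  then interpret oracle_search d F L lam r \<Delta> O1 O2
    by unfold_locales
  let ?B = "{y \<in> eucl d. norm y \<le> r}"
  have "?B \<noteq> {}" using zero_in_eucl r_pos by (auto intro!: exI[of _ 0])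
  then have INF: "v \<le> (INF y\<in>?B. F y + lam * (norm y)\<^sup>2) + \<Delta>"
    if "\<forall>y\<in>eucl d. norm y \<le> r \<longrightarrow> v \<le> F y + lam * (norm y)\<^sup>2 + \<Delta>" for v
  proof -
    have "v - \<Delta> \<le> (INF y\<in>?B. F y + lam * (norm y)\<^sup>2)"
      using \<open>?B \<noteq> {}\<close> that by (intro cINF_greatest) (auto simp: diff_le_eq)
    then show ?thesis by simp
  qed
  show "(\<exists>x n1 n2. binary_search lam r \<Delta> L O1 O2 x n1 n2) \<and>
    (\<forall>x n1 n2. binary_search lam r \<Delta> L O1 O2 x n1 n2 \<longrightarrow>
      x \<in> eucl d \<and> norm x \<le> r \<and>
      F x + lam * (norm x)\<^sup>2 \<le> (INF y\<in>?B. F y + lam * (norm y)\<^sup>2) + \<Delta> \<and>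
      real n1 \<le> 9 * max 1 (ln (L / (lam * r))) \<and>
      real n2 \<le> 7 * ln ((L * r + lam * r\<^sup>2) / \<Delta>))"
    using binary_search_correct INF by blast
qed

end
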